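(* Let $\{S_i\}_{i=1}^m$, $K$, $\Sigma=\{1,\ldots,m\}^{\mathbb N}$, $\pi$, $\mathbf p$, $\mu$, $F$, $A_n$, $B_n$, $R_n$ be as described in the context. Let $\omega\in\Sigma$, let $x=\pi(\omega)\in K$, and let $\alpha>0$. Then $$\lim_{\substack{y\to x,\ y\in K}}\frac{\log|F(y)-F(x)|}{\log|y-x|}=\alpha$$ (the limit exists and equals $\alpha$) if and only if $$\lim_{n\to\infty}\frac{A_n(\omega)}{B_n(\omega)}=\alpha\qquad\text{and}\qquad\lim_{n\to\infty}\frac{R_n(\omega)}{n}=0.$$
   Context: Setting. Let $m\ge 2$ and $S_i(x)=r_ix+t_i$ ($i=1,\ldots,m$) on $\mathbb R$, with $0<r_i<1$ and $0=t_1<t_2<\cdots<t_m<r_m+t_m=1$. The intervals $S_i([0,1])$, $i=1,\ldots,m$, are assumed pairwise disjoint. Let $K\subset[0,1]$ be the unique nonempty compact set with $K=\bigcup_{i=1}^m S_i(K)$. Let $\mathbf p=(p_1,\ldots,p_m)$ be a probability vector with all $p_i>0$, let $\mu$ be the unique Borel probability measure on $\mathbb R$ with $\mu=\sum_{i=1}^m p_i\,\mu\circ S_i^{-1}$ (its support is $K$), and let $F(x)=\mu([0,x])$ be its distribution function. Coding. $\Sigma=\{1,\ldots,m\}^{\mathbb N}$, and $\pi:\Sigma\to K$ is the bijection $\pi(\omega)=\lim_{n\to\infty}S_{\omega_1}\circ\cdots\circ S_{\omega_n}(0)$, $\omega=(\omega_1,\omega_2,\ldots)$. For $\omega\in\Sigma$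 and $n\ge1$, $$A_n(\omega)=-\sum_{k=1}^n\log p_{\omega_k},\qquad B_n(\omega)=-\sum_{k=1}^n\log r_{\omega_k}.$$ Endpoint runs. For $\omega\in\Sigma$ and $n\ge0$, $L_n^-(\omega)$ is the largest $\ell\ge1$ such that $\omega_{n+j}=1$ for all $j=1,\ldots,\ell$, if such a finite maximum exists; $L_n^-(\omega)=0$ if $\omega_{n+1}\neq1$, and also $L_n^-(\omega)=0$ if $\omega_{n+j}=1$ for all $j\ge1$. Likewise $L_n^+(\omega)$ is defined with the symbol $m$ in place of $1$ (and is $0$ if $\omega_{n+1}\ne m$ or if $\omega_{n+j}=m$ for all $j\ge1$). Set $R_n(\omega)=\max\{L_n^-(\omega),L_n^+(\omega)\}$. In the limit $y\to x$, $y\in K$, the points $y$ range over $K\setminus\{x\}$. *)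

theory Defs
  imports "HOL-Probability.Probability"
begin

text \<open>
  The data of the iterated function system are functions \<open>r\<close>, \<open>t\<close>, \<open>p\<close> on \<open>nat\<close>, of which only
  the values at the indices \<open>1, \<dots>, m\<close> matter.
\<close>

definition ifs_map :: "(nat \<Rightarrow> real) \<Rightarrow> (nat \<Rightarrow> real) \<Rightarrow> nat \<Rightarrow> real \<Rightarrow> real" where
  "ifs_map r t i x = r i * x + t i"

definition ifs_condition :: "nat \<Rightarrow> (nat \<Rightarrow> real) \<Rightarrow> (nat \<Rightarrow> real) \<Rightarrow> bool" where
  "ifs_condition m r t \<longleftrightarrow>
     2 \<le> m \<and>
     (\<forall>i\<in>{1..m}. 0 < r i \<and> r i < 1) \<and>
     t 1 = 0 \<and> strict_mono_on {1..m} t \<and> t m < r m + t m \<and> r m + t m = 1 \<and>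
     disjoint_family_on (\<lambda>i. ifs_map r t i ` {0..1}) {1..m}"

text \<open>
  By Hutchinson's theorem, exactly one set and exactly one measure satisfy the next two
  predicates when \<open>ifs_condition m r t\<close> and \<open>positive_prob_vector m p\<close> hold.
\<close>

definition is_attractor :: "nat \<Rightarrow> (nat \<Rightarrow> real) \<Rightarrow> (nat \<Rightarrow> real) \<Rightarrow> real set \<Rightarrow> bool" where
  "is_attractor m r t K \<longleftrightarrow>
     compact K \<and> K \<noteq> {} \<and> K = (\<Union>i\<in>{1..m}. ifs_map r t i ` K)"

definition is_self_similar_measure ::
    "nat \<Rightarrow> (nat \<Rightarrow> real) \<Rightarrow> (nat \<Rightarrow> real) \<Rightarrow> (nat \<Rightarrow> real) \<Rightarrow> real measure \<Rightarrow> bool" where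
  "is_self_similar_measure m r t p \<mu> \<longleftrightarrow>
     prob_space \<mu> \<and> sets \<mu> = sets borel \<and>
     (\<forall>B\<in>sets borel. measure \<mu> B = (\<Sum>i=1..m. p i * measure \<mu> (ifs_map r t i -` B)))"

definition positive_prob_vector :: "nat \<Rightarrow> (nat \<Rightarrow> real) \<Rightarrow> bool" where
  "positive_prob_vector m p \<longleftrightarrow> (\<forall>i\<in>{1..m}. 0 < p i) \<and> (\<Sum>i=1..m. p i) = 1"

definition dist_fun :: "real measure \<Rightarrow> real \<Rightarrow> real" where
  "dist_fun \<mu> x = measure \<mu> {0..x}"

text \<open>Symbols are indexed from \<open>1\<close>; extensionality fixes the irrelevant value \<open>\<omega> 0\<close>.\<close>

definition code_space :: "nat \<Rightarrow> (nat \<Rightarrow> nat) set" where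
  "code_space m = {1..} \<rightarrow>\<^sub>E {1..m}"

primrec word_map :: "(nat \<Rightarrow> real) \<Rightarrow> (nat \<Rightarrow> real) \<Rightarrow> (nat \<Rightarrow> nat) \<Rightarrow> nat \<Rightarrow> real \<Rightarrow> real" where
  "word_map r t \<omega> 0 = id"
| "word_map r t \<omega> (Suc n) = word_map r t \<omega> n \<circ> ifs_map r t (\<omega> (Suc n))"

definition coding_map :: "(nat \<Rightarrow> real) \<Rightarrow> (nat \<Rightarrow> real) \<Rightarrow> (nat \<Rightarrow> nat) \<Rightarrow> real" where
  "coding_map r t \<omega> = lim (\<lambda>n. word_map r t \<omega> n 0)"

text \<open>\<open>A\<^sub>n\<close> and \<open>B\<^sub>n\<close> are \<open>log_sum p\<close> and \<open>log_sum r\<close>.\<close>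

definition log_sum :: "(nat \<Rightarrow> real) \<Rightarrow> (nat \<Rightarrow> nat) \<Rightarrow> nat \<Rightarrow> real" where
  "log_sum q \<omega> n = - (\<Sum>k=1..n. ln (q (\<omega> k)))"

text \<open>
  \<open>run_set s \<omega> n\<close> is infinite when \<open>\<omega>\<close> is constantly \<open>s\<close> after position \<open>n\<close>; such an infinite run
  counts as length \<open>0\<close>.
\<close>

definition run_set :: "nat \<Rightarrow> (nat \<Rightarrow> nat) \<Rightarrow> nat \<Rightarrow> nat set" where
  "run_set s \<omega> n = {l. 1 \<le> l \<and> (\<forall>j\<in>{1..l}. \<omega> (n + j) = s)}"

definition run_length :: "nat \<Rightarrow> (nat \<Rightarrow> nat) \<Rightarrow> nat \<Rightarrow> nat" where
  "run_length s \<omega> n =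
     (if run_set s \<omega> n \<noteq> {} \<and> finite (run_set s \<omega> n) then Max (run_set s \<omega> n) else 0)"

definition endpoint_run :: "nat \<Rightarrow> (nat \<Rightarrow> nat) \<Rightarrow> nat \<Rightarrow> nat" where
  "endpoint_run m \<omega> n = max (run_length 1 \<omega> n) (run_length m \<omega> n)"

end

theory Submission
  imports Defs
begin

text \<open>
  Write \<open>S\<^sub>i\<close> for the maps, \<open>W\<^sub>n\<close> for the composition along the first \<open>n\<close> symbols of \<open>\<omega>\<close> and
  \<open>X\<^sub>n\<close> for the point coded by the shifted sequence, so that \<open>x = W\<^sub>n X\<^sub>n\<close>. A point \<open>y \<noteq> x\<close> of \<open>K\<close>
  shares with \<open>x\<close> a longest cylinder; say it has length \<open>n\<close>. Then \<open>y = W\<^sub>n z\<close>, where \<open>z\<close> lies in a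
  first-level piece \<open>S\<^sub>j K\<close> other than the piece of \<open>X\<^sub>n\<close>. Self-similarity of length and mass turns
  the quotient into
  \<open>(A\<^sub>n - ln \<bar>F z - F X\<^sub>n\<bar>) / (B\<^sub>n - ln \<bar>z - X\<^sub>n\<bar>)\<close>,
  and \<open>n\<close> tends to infinity as \<open>y\<close> tends to \<open>x\<close>. The distance between different pieces is
  bounded below, so the correction in the denominator is bounded, while \<open>B\<^sub>n\<close> grows linearly. All
  the difficulty is in the increment \<open>\<bar>F z - F X\<^sub>n\<bar>\<close>, which is small exactly when \<open>z\<close> and \<open>X\<^sub>n\<close> sit
  near the two ends of the same gap. If \<open>X\<^sub>n\<close> is in the piece \<open>i\<close> to the left of \<open>z\<close>, the increment
  is at least \<open>p\<^sub>i (1 - F X\<^sub>n\<^sub>+\<^sub>1)\<close>, with equality when \<open>z\<close> is the left end of the next piece. The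
  number \<open>1 - F X\<^sub>n\<^sub>+\<^sub>1\<close> is the mass between \<open>X\<^sub>n\<^sub>+\<^sub>1\<close> and the endpoint \<open>1\<close>, which lies between
  \<open>p\<^sub>m\<close> to the power \<open>L + 1\<close> and \<open>p\<^sub>m\<close> to the power \<open>L\<close> if the code of \<open>X\<^sub>n\<^sub>+\<^sub>1\<close> begins with
  exactly \<open>L\<close> symbols \<open>m\<close>. On the other side the same holds with the endpoint \<open>0\<close> and the symbol \<open>1\<close>.

  If \<open>A\<^sub>n / B\<^sub>n\<close> tends to \<open>\<alpha>\<close> and \<open>R\<^sub>n / n\<close> to \<open>0\<close>, the correction in the numerator is therefore
  negligible against \<open>B\<^sub>n\<close> and the quotient is squeezed to \<open>\<alpha>\<close> (lemma
  \<open>quot_of_log_ratio\<close>). Conversely, the quotient may be tested along one sibling point \<open>z\<close> for each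
  \<open>n\<close> (\<open>ratio_along_siblings\<close>). Points with a large increment give \<open>A\<^sub>n / B\<^sub>n \<longlonglongrightarrow> \<alpha>\<close>
  (\<open>log_ratio_of_quot\<close>). Points across the adjacent gap then show that the logarithm of the
  increment, and with it the run that starts at that position, is \<open>o(n)\<close> (\<open>run_length_of_quot\<close>).

  A tail of \<open>\<omega>\<close> that is constantly \<open>m\<close> makes \<open>1 - F X\<^sub>n\<close> vanish, but then \<open>X\<^sub>n\<close> is eventually the
  right end of the unit interval and has no sibling to its right; this is why infinite runs
  count as length \<open>0\<close>.
\<close>

section \<open>Run lengths\<close>

lemma run_length_eqI:
  assumes "\<And>j. j \<in> {1..l} \<Longrightarrow> \<omega> (n + j) = s" "\<omega> (Suc (n + l)) \<noteq> s"
  shows "run_length s \<omega> n = l"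
proof -
  have "run_set s \<omega> n = {1..l}"
  proof (intro equalityI subsetI)
    fix k assume k: "k \<in> run_set s \<omega> n"
    \<comment> \<open>A run longer than \<open>l\<close> would contain the position right after the first \<open>l\<close> symbols.\<close>
    have "\<not> l < k"
    proof
      assume "l < k"
      then have "\<omega> (n + Suc l) = s"
        using k by (auto simp: run_set_def simp del: add_Suc_right)
      then show False
        using assms(2) by simp
    qed
    then show "k \<in> {1..l}"
      using k by (auto simp: run_set_def)
  next
    fix k assume "k \<in> {1..l}"
    then show "k \<in> run_set s \<omega> n"
      using assms(1) by (auto simp: run_set_def)
  qed
  then show ?thesis
    by (cases "l = 0") (auto simp: run_length_def intro: Max_eqI)
qed

lemma run_length_tail_constant:
  assumes "\<And>j. n < j \<Longrightarrow> \<omega> j = s"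
  shows "run_length s \<omega> n = 0"
proof -
  have "run_set s \<omega> n = {1..}"
    using assms by (auto simp: run_set_def)
  then show ?thesis
    by (simp add: run_length_def infinite_Ici)
qed

lemma run_lengthD:
  assumes "\<exists>j>n. \<omega> j \<noteq> s"
  shows "\<And>j. j \<in> {1..run_length s \<omega> n} \<Longrightarrow> \<omega> (n + j) = s"
    and "\<omega> (Suc (n + run_length s \<omega> n)) \<noteq> s"
proof -
  define l where "l = (LEAST l. \<omega> (Suc (n + l)) \<noteq> s)"
  obtain j where "n < j" "\<omega> j \<noteq> s"
    using assms by blast
  then have "\<omega> (Suc (n + (j - Suc n))) \<noteq> s"
    by simp
  then have "\<exists>l. \<omega> (Suc (n + l)) \<noteq> s"
    by blast
  then have l: "\<omega> (Suc (n + l)) \<noteq> s"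
    unfolding l_def by (rule LeastI_ex)
  have below: "\<omega> (n + j) = s" if "j \<in> {1..l}" for j
  proof -
    have "j - 1 < l" "Suc (n + (j - 1)) = n + j"
      using that by auto
    then show ?thesis
      using not_less_Least[of "j - 1" "\<lambda>l. \<omega> (Suc (n + l)) \<noteq> s"] by (simp only: l_def not_not)
  qed
  have "run_length s \<omega> n = l"
    using below l by (rule run_length_eqI)
  with below l show "\<And>j. j \<in> {1..run_length s \<omega> n} \<Longrightarrow> \<omega> (n + j) = s"
    and "\<omega> (Suc (n + run_length s \<omega> n)) \<noteq> s"
    by simp_all
qed

lemma run_length_pos_imp_tail:
  assumes "0 < run_length s \<omega> n"
  shows "\<exists>j>n. \<omega> j \<noteq> s"
  using assms run_length_tail_constant[of n \<omega> s] by auto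

lemma run_length_extend:
  assumes "\<omega> (Suc n) = s" "0 < run_length s \<omega> (Suc n)"
  shows "run_length s \<omega> n = Suc (run_length s \<omega> (Suc n))"
proof (rule run_length_eqI)
  note tail = run_lengthD[OF run_length_pos_imp_tail[OF assms(2)]]
  show "\<omega> (Suc (n + Suc (run_length s \<omega> (Suc n)))) \<noteq> s"
    using tail(2) by simp
  fix j assume "j \<in> {1..Suc (run_length s \<omega> (Suc n))}"
  then consider "j = 1" | "j - 1 \<in> {1..run_length s \<omega> (Suc n)}" "Suc n + (j - 1) = n + j"
    by fastforce
  then show "\<omega> (n + j) = s"
    by cases (use assms(1) tail(1)[of "j - 1"] in auto)
qed

text \<open>
  A run read off in its interior is the end of a longer run that begins earlier, so only runs read
  off at their beginning need to be controlled. The runs that begin within a bounded initial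
  segment end before a fixed position.
\<close>
lemma run_length_negligible:
  assumes "\<And>\<epsilon>. 0 < \<epsilon> \<Longrightarrow>
    \<exists>N. \<forall>n\<ge>N. \<omega> (Suc n) \<noteq> s \<longrightarrow> real (run_length s \<omega> (Suc n)) \<le> \<epsilon> * real n"
  shows "(\<lambda>n. real (run_length s \<omega> n) / real n) \<longlonglongrightarrow> 0"
proof (rule LIMSEQ_I)
  let ?L = "run_length s \<omega>"
  fix \<epsilon> :: real assume "0 < \<epsilon>"
  then obtain N where N: "\<And>n. N \<le> n \<Longrightarrow> \<omega> (Suc n) \<noteq> s \<Longrightarrow> real (?L (Suc n)) \<le> \<epsilon> / 2 * real n"
    using assms[of "\<epsilon> / 2"] by auto
  \<comment> \<open>No run that begins at or before \<open>N\<close> reaches beyond position \<open>T\<close>.\<close>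
  define T where "T = Max ((\<lambda>j. ?L j + j) ` {..N})"
  have T: "?L j + j \<le> T" if "j \<le> N" for j
    unfolding T_def using that by (intro Max_ge) auto
  have dichotomy: "real (?L k) \<le> \<epsilon> / 2 * real k \<or> ?L k + k \<le> T" for k
  proof (induction k)
    case 0
    then show ?case
      using T[of 0] by simp
  next
    case (Suc k)
    have mono: "\<epsilon> / 2 * real k \<le> \<epsilon> / 2 * real (Suc k)"
      using \<open>0 < \<epsilon>\<close> by simp
    show ?case
    proof (cases "\<omega> (Suc k) = s")
      case True
      show ?thesis
      proof (cases "?L (Suc k) = 0")
        case False
        then have "?L k = Suc (?L (Suc k))"
          using run_length_extend[of \<omega> k s] True by simp
        then show ?thesis
          using Suc mono by auto
      qed (use \<open>0 < \<epsilon>\<close> in simp)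
    next
      case False
      then show ?thesis
        using N[of k] T[of "Suc k"] mono by (cases "N \<le> k") auto
    qed
  qed
  show "\<exists>n0. \<forall>n\<ge>n0. norm (real (?L n) / real n - 0) < \<epsilon>"
  proof (intro exI allI impI)
    fix n assume "Suc T \<le> n"
    then have "real (?L n) \<le> \<epsilon> / 2 * real n" "0 < n"
      using dichotomy[of n] by auto
    then show "norm (real (?L n) / real n - 0) < \<epsilon>"
      using \<open>0 < \<epsilon>\<close> by (simp add: divide_less_eq) (smt (verit) mult_pos_pos of_nat_0_less_iff field_sum_of_halves distrib_right)
  qed
qed

section \<open>Pieces and gaps\<close>

locale cantor_system =
  fixes m :: nat and r t p :: "nat \<Rightarrow> real" and K :: "real set" and \<mu> :: "real measure"
  assumes ifs: "ifs_condition m r t"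
    and attractor: "is_attractor m r t K"
    and weights: "positive_prob_vector m p"
    and self_similar: "is_self_similar_measure m r t p \<mu>"
begin

abbreviation "S \<equiv> ifs_map r t"
abbreviation "F \<equiv> dist_fun \<mu>"

lemma m_ge_2: "2 \<le> m"
  using ifs by (simp add: ifs_condition_def)

lemma r_pos: "i \<in> {1..m} \<Longrightarrow> 0 < r i"
  and r_less_1: "i \<in> {1..m} \<Longrightarrow> r i < 1"
  using ifs by (auto simp: ifs_condition_def)

lemma t_first: "t 1 = 0"
  and t_last: "r m + t m = 1"
  using ifs by (auto simp: ifs_condition_def)

lemma pieces_ordered:
  assumes "i \<in> {1..m}" "j \<in> {1..m}" "i < j"
  shows "t i + r i < t j"
proof (rule ccontr)
  assume "\<not> t i + r i < t j"
  moreover have "t i < t j"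
    using ifs assms by (auto simp: ifs_condition_def strict_mono_on_def)
  moreover have ri: "0 < r i"
    using r_pos assms by blast
  ultimately have "(t j - t i) / r i \<in> {0..1}" "t j = S i ((t j - t i) / r i)"
    by (auto simp: ifs_map_def field_simps)
  then have "t j \<in> S i ` {0..1}"
    by blast
  moreover have "t j = S j 0"
    by (simp add: ifs_map_def)
  then have "t j \<in> S j ` {0..1}"
    by (metis atLeastAtMost_iff image_eqI order_refl zero_le_one)
  moreover have "S i ` {0..1} \<inter> S j ` {0..1} = {}"
    using ifs assms by (auto simp: ifs_condition_def disjoint_family_on_def)
  ultimately show False
    by blast
qed

lemma t_nonneg: "i \<in> {1..m} \<Longrightarrow> 0 \<le> t i"
  using pieces_ordered[of 1 i] r_pos[of 1] t_first m_ge_2 by (cases "i = 1") auto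

lemma piece_right_le_1: "i \<in> {1..m} \<Longrightarrow> r i + t i \<le> 1"
  using pieces_ordered[of i m] r_pos[of m] t_last m_ge_2 by (cases "i = m") auto

lemma ifs_map_in_unit:
  assumes "i \<in> {1..m}" "u \<in> {0..1}"
  shows "S i u \<in> {0..1}"
proof -
  have "0 \<le> r i * u" "r i * u \<le> r i"
    using assms r_pos[of i] by (auto simp: mult_left_le)
  then show ?thesis
    using t_nonneg[of i] piece_right_le_1[of i] assms by (auto simp: ifs_map_def)
qed

lemma uniform_gap:
  obtains \<delta> where "0 < \<delta>" "\<delta> \<le> 1"
    "\<And>i j u v. \<lbrakk>i \<in> {1..m}; j \<in> {1..m}; i \<noteq> j; u \<in> {0..1}; v \<in> {0..1}\<rbrakk> \<Longrightarrow> \<delta> \<le> \<bar>S i u - S j v\<bar>"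
proof -
  define P where "P = {(i, j) \<in> {1..m} \<times> {1..m}. i < j}"
  define D where "D = insert 1 ((\<lambda>(i, j). t j - (t i + r i)) ` P)"
  have "finite D"
    unfolding D_def P_def by (intro finite.insertI finite_imageI finite_subset[OF _ finite_cartesian_product]) auto
  then have min: "Min D \<in> D" and le: "\<And>d. d \<in> D \<Longrightarrow> Min D \<le> d"
    using Min_in[of D] Min_le[of D] by (auto simp: D_def)
  have "0 < d" if "d \<in> D" for d
    using that pieces_ordered by (auto simp: D_def P_def)
  with min have pos: "0 < Min D"
    by blast
  have one: "Min D \<le> 1"
    by (rule le) (simp add: D_def)
  have less: "Min D \<le> S j v - S i u"
    if "i \<in> {1..m}" "j \<in> {1..m}" "i < j" "u \<in> {0..1}" "v \<in> {0..1}" for i j u v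
  proof -
    have "Min D \<le> t j - (t i + r i)"
      by (rule le) (use that in \<open>auto simp: D_def P_def\<close>)
    moreover have "0 \<le> r j * v" "r i * u \<le> r i"
      using that r_pos[of i] r_pos[of j] by (auto simp: mult_left_le)
    ultimately show ?thesis
      by (simp add: ifs_map_def)
  qed
  show thesis
  proof (rule that[OF pos one])
    fix i j u v
    assume "i \<in> {1..m}" "j \<in> {1..m}" "i \<noteq> j" "u \<in> {0..1::real}" "v \<in> {0..1::real}"
    then show "Min D \<le> \<bar>S i u - S j v\<bar>"
      using less[of i j u v] less[of j i v u] by (cases i j rule: linorder_cases) auto
  qed
qed

section \<open>The attractor\<close>

lemma attractor_compact: "compact K"
  and attractor_nonempty: "K \<noteq> {}"
  using attractor unfolding is_attractor_def by blast+

lemma attractor_eq: "K = (\<Union>i\<in>{1..m}. S i ` K)"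
  using attractor unfolding is_attractor_def by blast

lemma ifs_map_in_attractor: "\<lbrakk>i \<in> {1..m}; z \<in> K\<rbrakk> \<Longrightarrow> S i z \<in> K"
  using attractor_eq by blast

lemma attractor_cases:
  assumes "z \<in> K"
  obtains i w where "i \<in> {1..m}" "w \<in> K" "z = S i w"
  using assms attractor_eq by blast

text \<open>A maximum of \<^term>\<open>K\<close> beyond \<open>1\<close> would be the image of a point of \<^term>\<open>K\<close> still further
  to the right, since every map contracts towards a fixed point in the unit interval; likewise
  for a minimum below \<open>0\<close>.\<close>
lemma attractor_subset_unit: "K \<subseteq> {0..1}"
proof -
  note K = attractor_compact attractor_nonempty
  obtain b where b: "b \<in> K" "\<And>z. z \<in> K \<Longrightarrow> z \<le> b"
    using compact_attains_sup[OF K] by blast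
  obtain i w where iw: "i \<in> {1..m}" "w \<in> K" "b = S i w"
    using attractor_cases[OF b(1)] by blast
  have "r i * w \<le> r i * b"
    using b(2)[OF iw(2)] r_pos[OF iw(1)] by simp
  then have "b \<le> r i * b + (1 - r i)"
    using piece_right_le_1[OF iw(1)] iw(3) unfolding ifs_map_def by linarith
  then have "(1 - r i) * (b - 1) \<le> 0"
    by (simp add: algebra_simps)
  then have "b \<le> 1"
    using r_less_1[OF iw(1)] by (simp add: mult_le_0_iff)
  obtain a where a: "a \<in> K" "\<And>z. z \<in> K \<Longrightarrow> a \<le> z"
    using compact_attains_inf[OF K] by blast
  obtain j v where jv: "j \<in> {1..m}" "v \<in> K" "a = S j v"
    using attractor_cases[OF a(1)] by blast
  have "r j * a \<le> r j * v"
    using a(2)[OF jv(2)] r_pos[OF jv(1)] by simp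
  then have "r j * a \<le> a"
    using t_nonneg[OF jv(1)] jv(3) unfolding ifs_map_def by linarith
  then have "0 \<le> (1 - r j) * a"
    by (simp add: algebra_simps)
  then have "0 \<le> a"
    using r_less_1[OF jv(1)] by (simp add: zero_le_mult_iff)
  show ?thesis
  proof
    fix z assume "z \<in> K"
    then show "z \<in> {0..1}"
      using \<open>b \<le> 1\<close> \<open>0 \<le> a\<close> a(2)[of z] b(2)[of z] by simp
  qed
qed

text \<open>The orbit of any point of \<^term>\<open>K\<close> under the map stays in \<^term>\<open>K\<close> and converges to the
  fixed point.\<close>
lemma fixed_point_in_attractor:
  assumes "i \<in> {1..m}" "S i c = c"
  shows "c \<in> K"
proof -
  obtain z where z: "z \<in> K"
    using attractor_nonempty by blast
  have K: "(S i ^^ n) z \<in> K" for n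
    by (induction n) (use z assms ifs_map_in_attractor in auto)
  have "(S i ^^ n) z = c + r i ^ n * (z - c)" for n
  proof (induction n)
    case (Suc n)
    have "S i (c + d) = c + r i * d" for d
      using assms(2) by (simp add: ifs_map_def algebra_simps)
    then show ?case
      using Suc by (simp add: mult.assoc)
  qed simp
  moreover have "(\<lambda>n. c + r i ^ n * (z - c)) \<longlonglongrightarrow> c + 0 * (z - c)"
    using r_pos[OF assms(1)] r_less_1[OF assms(1)] by (intro tendsto_intros LIMSEQ_power_zero) auto
  ultimately have "(\<lambda>n. (S i ^^ n) z) \<longlonglongrightarrow> c"
    by simp
  moreover have "closed K"
    by (rule compact_imp_closed[OF attractor_compact])
  ultimately show ?thesis
    using K closed_sequentially[of K "\<lambda>n. (S i ^^ n) z" c] by simp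
qed

lemma zero_in_attractor: "0 \<in> K"
  using fixed_point_in_attractor[of 1 0] m_ge_2 t_first by (simp add: ifs_map_def)

lemma one_in_attractor: "1 \<in> K"
  using fixed_point_in_attractor[of m 1] m_ge_2 t_last by (simp add: ifs_map_def)

section \<open>Mass and distribution function\<close>

lemma p_pos: "i \<in> {1..m} \<Longrightarrow> 0 < p i"
  and p_sum: "(\<Sum>i=1..m. p i) = 1"
  using weights by (auto simp: positive_prob_vector_def)

lemma sum_p_le:
  assumes "J \<subseteq> I" "I \<subseteq> {1..m}"
  shows "sum p J \<le> sum p I"
proof (rule sum_mono2)
  show "finite I"
    using assms(2) by (rule finite_subset) simp
  show "0 \<le> p i" if "i \<in> I - J" for i
    using that assms(2) p_pos[of i] by auto
qed (fact assms(1))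

lemma p_less_1:
  assumes "i \<in> {1..m}"
  shows "p i < 1"
proof -
  obtain j where j: "j \<in> {1..m}" "j \<noteq> i"
    using m_ge_2 that[of 1] that[of 2] by (cases "i = 1") auto
  have "sum p {i, j} \<le> sum p {1..m}"
    using assms j by (intro sum_p_le) auto
  then show ?thesis
    using j p_pos[OF j(1)] p_sum by simp
qed

lemma uniform_weight:
  obtains q where "0 < q" "q < 1" "\<And>i. i \<in> {1..m} \<Longrightarrow> q \<le> p i"
proof -
  have ne: "p ` {1..m} \<noteq> {}"
    using m_ge_2 by auto
  have min: "Min (p ` {1..m}) \<in> p ` {1..m}"
    using ne by (intro Min_in) auto
  show thesis
  proof (rule that[of "Min (p ` {1..m})"])
    show "0 < Min (p ` {1..m})" "Min (p ` {1..m}) < 1"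
      using min p_pos p_less_1 by auto
  qed auto
qed

lemma prob_space_measure: "prob_space \<mu>"
  and sets_measure: "sets \<mu> = sets borel"
  and measure_eq: "B \<in> sets borel \<Longrightarrow> measure \<mu> B = (\<Sum>i=1..m. p i * measure \<mu> (S i -` B))"
  using self_similar by (auto simp: is_self_similar_measure_def)

sublocale prob_space \<mu>
  by (rule prob_space_measure)

lemma ifs_map_vimage_borel: "B \<in> sets borel \<Longrightarrow> S i -` B \<in> sets \<mu>"
  unfolding sets_measure ifs_map_def[abs_def]
  by (rule measurable_sets_borel[of _ borel]) auto

text \<open>
  If \<open>\<rho>\<close> bounds the contraction ratios, the preimage under each map of the exterior of the
  \<open>a\<close>-neighbourhood of the unit interval lies outside the \<open>a/\<rho>\<close>-neighbourhood. So this exterior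
  has no more mass than the exteriors of arbitrarily large neighbourhoods.
\<close>
lemma measure_outside_unit: "measure \<mu> (- {0..1}) = 0"
proof -
  define \<rho> where "\<rho> = Max (r ` {1..m})"
  have ne: "r ` {1..m} \<noteq> {}"
    using m_ge_2 by auto
  then have "\<rho> \<in> r ` {1..m}"
    unfolding \<rho>_def by (intro Max_in) auto
  then have \<rho>: "0 < \<rho>" "\<rho> < 1"
    using r_pos r_less_1 by auto
  have r_le: "r i \<le> \<rho>" if "i \<in> {1..m}" for i
    unfolding \<rho>_def using that by auto
  define E :: "real \<Rightarrow> real set" where "E a = - {-a..1 + a}" for a
  have E_sets: "E a \<in> sets borel" for a
    by (simp add: E_def)
  have step: "measure \<mu> (E a) \<le> measure \<mu> (E (a / \<rho>))" if "0 \<le> a" for a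
  proof -
    have "S i -` E a \<subseteq> E (a / \<rho>)" if i: "i \<in> {1..m}" for i
    proof -
      have "r i * y \<le> r i + a" if "y \<le> 1 + a / \<rho>" for y
      proof -
        have "r i * y \<le> r i * (1 + a / \<rho>)"
          using that r_pos[OF i] by (intro mult_left_mono) auto
        also have "\<dots> \<le> r i + a"
          using \<open>0 \<le> a\<close> \<rho> mult_right_mono[OF r_le[OF i], of "a / \<rho>"] by (simp add: distrib_left)
        finally show ?thesis .
      qed
      moreover have "- a \<le> r i * y" if "- (a / \<rho>) \<le> y" for y
      proof -
        have "r i * (- (a / \<rho>)) \<le> r i * y"
          using that r_pos[OF i] by (intro mult_left_mono) auto
        moreover have "r i * (a / \<rho>) \<le> \<rho> * (a / \<rho>)"
          using \<open>0 \<le> a\<close> \<rho> by (intro mult_right_mono r_le i) auto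
        ultimately show ?thesis
          using \<rho> by simp
      qed
      ultimately show ?thesis
        using t_nonneg[OF i] piece_right_le_1[OF i]
        by (fastforce simp: E_def ifs_map_def)
    qed
    then have "p i * measure \<mu> (S i -` E a) \<le> p i * measure \<mu> (E (a / \<rho>))" if "i \<in> {1..m}" for i
      using that p_pos[OF that] E_sets sets_measure
      by (intro mult_left_mono finite_measure_mono) auto
    then have "measure \<mu> (E a) \<le> (\<Sum>i=1..m. p i * measure \<mu> (E (a / \<rho>)))"
      unfolding measure_eq[OF E_sets] by (rule sum_mono)
    then show ?thesis
      using p_sum by (simp flip: sum_distrib_right)
  qed
  have zero: "measure \<mu> (E a) = 0" if "0 < a" for a
  proof -
    have le: "measure \<mu> (E a) \<le> measure \<mu> (E (a / \<rho> ^ n))" for n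
    proof (induction n)
      case (Suc n)
      have "measure \<mu> (E (a / \<rho> ^ n)) \<le> measure \<mu> (E (a / \<rho> ^ n / \<rho>))"
        using that \<rho> by (intro step) auto
      with Suc show ?case
        by (simp add: mult.commute)
    qed simp
    have dec: "decseq (\<lambda>n. E (a / \<rho> ^ n))"
    proof (rule decseq_SucI)
      fix n
      have "a / \<rho> ^ n \<le> a / \<rho> ^ Suc n"
        using that \<rho> by (intro divide_left_mono) (auto intro: mult_left_le_one_le)
      then show "E (a / \<rho> ^ Suc n) \<subseteq> E (a / \<rho> ^ n)"
        by (auto simp: E_def)
    qed
    have "(\<Inter>n. E (a / \<rho> ^ n)) = {}"
    proof -
      have "\<exists>n. y \<notin> E (a / \<rho> ^ n)" for y
      proof -
        obtain n where "\<bar>y\<bar> / a < (1 / \<rho>) ^ n"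
          using real_arch_pow[of "1 / \<rho>" "\<bar>y\<bar> / a"] \<rho> by auto
        then have "\<bar>y\<bar> \<le> a / \<rho> ^ n"
          using that \<rho> by (simp add: field_simps)
        then show ?thesis
          by (intro exI[of _ n]) (auto simp: E_def)
      qed
      then show ?thesis
        by blast
    qed
    moreover have "(\<lambda>n. measure \<mu> (E (a / \<rho> ^ n))) \<longlonglongrightarrow> measure \<mu> (\<Inter>n. E (a / \<rho> ^ n))"
      using E_sets sets_measure dec by (intro finite_Lim_measure_decseq) auto
    ultimately have "(\<lambda>n. measure \<mu> (E (a / \<rho> ^ n))) \<longlonglongrightarrow> 0"
      by simp
    then have "measure \<mu> (E a) \<le> 0"
      by (rule Lim_bounded2[where N = 0]) (use le in auto)
    then show ?thesis
      by (simp add: measure_le_0_iff)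
  qed
  have "- {0..1} = (\<Union>n. E (1 / Suc n))"
  proof -
    have "\<exists>n. y \<in> E (1 / Suc n)" if y: "y \<notin> {0..1}" for y
    proof (cases "y < 0")
      case True
      then obtain n where "1 / Suc n < - y"
        using nat_approx_posE[of "- y"] by auto
      then show ?thesis
        by (intro exI[of _ n]) (simp add: E_def)
    next
      case False
      with y obtain n where "1 / Suc n < y - 1"
        using nat_approx_posE[of "y - 1"] by auto
      then show ?thesis
        by (intro exI[of _ n]) (simp add: E_def)
    qed
    moreover have "E (1 / Suc n) \<subseteq> - {0..1}" for n
      by (auto simp: E_def add_increasing2 order_trans[of _ 0])
    ultimately show ?thesis
      by blast
  qed
  moreover have "(\<Union>n. E (1 / Suc n)) \<in> null_sets \<mu>"
    using zero E_sets sets_measure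
    by (intro null_sets_UN) (auto simp: null_sets_def emeasure_eq_measure)
  ultimately show ?thesis
    by (simp add: null_sets_def emeasure_eq_measure)
qed

lemma measure_superset_unit:
  assumes "{0..1} \<subseteq> B" "B \<in> sets \<mu>"
  shows "measure \<mu> B = 1"
proof -
  have "measure \<mu> {0..1} = 1"
    using prob_compl[of "{0..1}"] measure_outside_unit sets_measure sets_eq_imp_space_eq[OF sets_measure]
    by (simp add: Compl_eq_Diff_UNIV)
  then show ?thesis
    using finite_measure_mono[OF assms] prob_le_1[of B] by linarith
qed

lemma measure_inter_unit:
  assumes "B \<in> sets \<mu>" "B' \<in> sets \<mu>" "B \<inter> {0..1} = B' \<inter> {0..1}"
  shows "measure \<mu> B = measure \<mu> B'"
proof -
  have "AE z in \<mu>. z \<in> {0..1}"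
  proof (rule AE_I')
    show "- {0..1} \<in> null_sets \<mu>"
      using measure_outside_unit sets_measure by (auto simp: null_sets_def emeasure_eq_measure)
  qed auto
  then have "AE z in \<mu>. z \<in> B \<longleftrightarrow> z \<in> B'"
    by eventually_elim (use assms(3) in blast)
  then show ?thesis
    using assms by (intro finite_measure_eq_AE) auto
qed

text \<open>The pieces to the left of the \<open>i\<close>-th one lie entirely below \<open>S i z\<close>, those to its right
  entirely above.\<close>
lemma dist_fun_ifs_map:
  assumes i: "i \<in> {1..m}" and z: "z \<in> {0..1}"
  shows "F (S i z) = sum p {1..<i} + p i * F z"
proof -
  have meas: "S k -` {0..S i z} \<in> sets \<mu>" for k
    by (rule ifs_map_vimage_borel) simp
  have "measure \<mu> (S k -` {0..S i z}) = (if k < i then 1 else if k = i then F z else 0)"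
    if k: "k \<in> {1..m}" for k
  proof (cases k i rule: linorder_cases)
    case less
    have "S k u \<le> S i z" if "u \<in> {0..1}" for u
    proof -
      have "r k * u \<le> r k" "0 \<le> r i * z"
        using that z r_pos[OF i] r_pos[OF k] by (auto simp: mult_left_le)
      then show ?thesis
        using pieces_ordered[OF k i less] by (simp add: ifs_map_def)
    qed
    then have "{0..1} \<subseteq> S k -` {0..S i z}"
      using ifs_map_in_unit[OF k] by auto
    then show ?thesis
      using measure_superset_unit meas less by simp
  next
    case equal
    have "S i u \<le> S i z \<longleftrightarrow> u \<le> z" for u
      using r_pos[OF i] by (simp add: ifs_map_def)
    then have "S k -` {0..S i z} \<inter> {0..1} = {0..z} \<inter> {0..1}"
      using ifs_map_in_unit[OF i] equal by auto
    then have "measure \<mu> (S k -` {0..S i z}) = measure \<mu> {0..z}"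
      by (intro measure_inter_unit meas) (simp_all add: sets_measure)
    then show ?thesis
      using equal by (simp add: dist_fun_def)
  next
    case greater
    have "S i z < S k u" if "u \<in> {0..1}" for u
    proof -
      have "0 \<le> r k * u" "r i * z \<le> r i"
        using that z r_pos[OF i] r_pos[OF k] by (auto simp: mult_left_le)
      then show ?thesis
        using pieces_ordered[OF i k greater] by (simp add: ifs_map_def)
    qed
    then have "S k -` {0..S i z} \<inter> {0..1} = {} \<inter> {0..1}"
      by fastforce
    then have "measure \<mu> (S k -` {0..S i z}) = measure \<mu> {}"
      by (intro measure_inter_unit meas) simp_all
    then show ?thesis
      using greater by simp
  qed
  then have "F (S i z) = (\<Sum>k=1..m. p k * (if k < i then 1 else if k = i then F z else 0))"
    unfolding dist_fun_def[of \<mu> "S i z"] using measure_eq[of "{0..S i z}"] by simp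
  also have "\<dots> = (\<Sum>k=1..m. (if k \<in> {1..<i} then p k else 0) + (if k = i then p i * F z else 0))"
    by (rule sum.cong) auto
  also have "\<dots> = (\<Sum>k=1..m. if k \<in> {1..<i} then p k else 0) + p i * F z"
    using i by (simp add: sum.distrib)
  also have "(\<Sum>k=1..m. if k \<in> {1..<i} then p k else 0) = sum p ({1..m} \<inter> {1..<i})"
    by (subst sum.inter_restrict) auto
  also have "{1..m} \<inter> {1..<i} = {1..<i}"
    using i by auto
  finally show ?thesis .
qed

lemma dist_fun_nonneg: "0 \<le> F z"
  and dist_fun_le_1: "F z \<le> 1"
  by (simp_all add: dist_fun_def)

text \<open>
  The origin is the fixed point of the first map, so the mass of \<open>{0}\<close> reproduces itself with a
  factor \<open>p 1 < 1\<close>.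
\<close>
lemma dist_fun_0: "F 0 = 0"
  using dist_fun_ifs_map[of 1 0] p_less_1[of 1] m_ge_2 t_first by (simp add: ifs_map_def)

lemma dist_fun_1: "F 1 = 1"
  using measure_superset_unit[of "{0..1}"] by (simp add: dist_fun_def sets_measure)

text \<open>
  The pieces before \<open>j\<close> contain those before \<open>i\<close> and the piece \<open>i\<close> itself: in terms of
  mass, the \<open>i\<close>-th piece ends before the \<open>j\<close>-th one begins.
\<close>
lemma weight_split:
  assumes "i \<in> {1..m}" "j \<in> {1..m}" "i < j"
  shows "sum p {1..<i} + p i \<le> sum p {1..<j}"
proof -
  have "sum p (insert i {1..<i}) \<le> sum p {1..<j}"
    using assms by (intro sum_p_le) auto
  then show ?thesis
    by simp
qed

lemma weight_total: "sum p {1..<m} + p m = 1"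
proof -
  have "{1..m} = insert m {1..<m}"
    using m_ge_2 by auto
  then show ?thesis
    using p_sum by simp
qed

section \<open>Words and codes\<close>

lemma word_map_in_unit:
  assumes "\<tau> \<in> {1..} \<rightarrow> {1..m}" "z \<in> {0..1}"
  shows "word_map r t \<tau> n z \<in> {0..1}"
  using assms(2)
proof (induction n arbitrary: z)
  case (Suc n)
  show ?case
    unfolding word_map.simps o_apply using funcset_mem[OF assms(1), of "Suc n"] Suc.prems by (intro Suc.IH ifs_map_in_unit) auto
qed simp

lemma word_map_in_attractor:
  assumes "\<tau> \<in> {1..} \<rightarrow> {1..m}" "z \<in> K"
  shows "word_map r t \<tau> n z \<in> K"
  using assms(2)
proof (induction n arbitrary: z)
  case (Suc n)
  show ?case
    unfolding word_map.simps o_apply using funcset_mem[OF assms(1), of "Suc n"] Suc.prems by (intro Suc.IH ifs_map_in_attractor) auto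
qed simp

text \<open>
  The recursion defining the word map appends a symbol at the inner end; the shift of the code
  needs the first symbol at the outer end.
\<close>
lemma word_map_head:
  "word_map r t \<tau> (Suc n) z = S (\<tau> 1) (word_map r t (\<lambda>k. \<tau> (Suc k)) n z)"
  by (induction n arbitrary: z) auto

lemma log_sum_Suc: "log_sum q \<tau> (Suc n) = log_sum q \<tau> n - ln (q (\<tau> (Suc n)))"
  by (simp add: log_sum_def)

lemma word_map_diff:
  assumes "\<tau> \<in> {1..} \<rightarrow> {1..m}"
  shows "word_map r t \<tau> n u - word_map r t \<tau> n v = exp (- log_sum r \<tau> n) * (u - v)"
proof (induction n arbitrary: u v)
  case 0
  then show ?case
    by (simp add: log_sum_def)
next
  case (Suc n)
  have "exp (- log_sum r \<tau> (Suc n)) = exp (- log_sum r \<tau> n) * r (\<tau> (Suc n))"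
    using r_pos[OF funcset_mem[OF assms, of "Suc n"]] by (simp add: log_sum_Suc exp_diff exp_minus field_simps)
  then show ?case
    using Suc[of "S (\<tau> (Suc n)) u" "S (\<tau> (Suc n)) v"] by (simp add: ifs_map_def algebra_simps)
qed

lemma dist_fun_word_map_diff:
  assumes "\<tau> \<in> {1..} \<rightarrow> {1..m}" "u \<in> {0..1}" "v \<in> {0..1}"
  shows "F (word_map r t \<tau> n u) - F (word_map r t \<tau> n v) = exp (- log_sum p \<tau> n) * (F u - F v)"
  using assms(2,3)
proof (induction n arbitrary: u v)
  case 0
  then show ?case
    by (simp add: log_sum_def)
next
  case (Suc n)
  have \<tau>: "\<tau> (Suc n) \<in> {1..m}"
    using funcset_mem[OF assms(1), of "Suc n"] by simp
  have "exp (- log_sum p \<tau> (Suc n)) = exp (- log_sum p \<tau> n) * p (\<tau> (Suc n))"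
    using p_pos[OF \<tau>] by (simp add: log_sum_Suc exp_diff exp_minus field_simps)
  then show ?case
    using Suc.IH[OF ifs_map_in_unit[OF \<tau> Suc.prems(1)] ifs_map_in_unit[OF \<tau> Suc.prems(2)]]
      dist_fun_ifs_map[OF \<tau>] Suc.prems
    by (simp add: algebra_simps)
qed

text \<open>
  The approximations from the base point \<open>0\<close> increase because no map moves \<open>0\<close> to the left, so
  they converge and \<^const>\<open>coding_map\<close>, a limit chosen by description, is a genuine limit.
\<close>
lemma word_map_converges:
  assumes "\<tau> \<in> {1..} \<rightarrow> {1..m}"
  shows "(\<lambda>n. word_map r t \<tau> n 0) \<longlonglongrightarrow> coding_map r t \<tau>"
    and "coding_map r t \<tau> \<in> {0..1}"
proof -
  have unit: "word_map r t \<tau> n 0 \<in> {0..1}" for n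
    using assms by (intro word_map_in_unit) auto
  have inc: "incseq (\<lambda>n. word_map r t \<tau> n 0)"
  proof (rule incseq_SucI)
    fix n
    have "0 \<le> exp (- log_sum r \<tau> n) * (S (\<tau> (Suc n)) 0 - 0)"
      using t_nonneg[OF funcset_mem[OF assms, of "Suc n"]] by (simp add: ifs_map_def)
    then show "word_map r t \<tau> n 0 \<le> word_map r t \<tau> (Suc n) 0"
      using word_map_diff[OF assms, of n "S (\<tau> (Suc n)) 0" 0] by simp
  qed
  have "convergent (\<lambda>n. word_map r t \<tau> n 0)"
    using inc unit by (auto intro: incseq_convergent[of _ 1] simp: convergent_def)
  then show lim: "(\<lambda>n. word_map r t \<tau> n 0) \<longlonglongrightarrow> coding_map r t \<tau>"
    unfolding coding_map_def by (simp add: convergent_LIMSEQ_iff)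
  show "coding_map r t \<tau> \<in> {0..1}"
    by (rule closed_sequentially[OF closed_atLeastAtMost unit lim])
qed

lemma coding_map_step:
  assumes "\<tau> \<in> {1..} \<rightarrow> {1..m}"
  shows "coding_map r t \<tau> = S (\<tau> 1) (coding_map r t (\<lambda>k. \<tau> (Suc k)))"
proof (rule LIMSEQ_unique)
  show "(\<lambda>n. word_map r t \<tau> (Suc n) 0) \<longlonglongrightarrow> coding_map r t \<tau>"
    using word_map_converges(1)[OF assms] by (rule LIMSEQ_Suc)
  have "(\<lambda>n. word_map r t (\<lambda>k. \<tau> (Suc k)) n 0) \<longlonglongrightarrow> coding_map r t (\<lambda>k. \<tau> (Suc k))"
    using assms by (intro word_map_converges(1)) auto
  then show "(\<lambda>n. word_map r t \<tau> (Suc n) 0) \<longlonglongrightarrow> S (\<tau> 1) (coding_map r t (\<lambda>k. \<tau> (Suc k)))"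
    unfolding word_map_head ifs_map_def by (intro tendsto_intros)
qed

end

section \<open>Comparing a coded point with its neighbours\<close>

locale coded_point = cantor_system +
  fixes \<omega> :: "nat \<Rightarrow> nat"
  assumes code: "\<omega> \<in> code_space m"
begin

abbreviation "W \<equiv> word_map r t \<omega>"
abbreviation "A \<equiv> log_sum p \<omega>"
abbreviation "B \<equiv> log_sum r \<omega>"
abbreviation "x \<equiv> coding_map r t \<omega>"
abbreviation "quot y \<equiv> ln \<bar>F y - F x\<bar> / ln \<bar>y - x\<bar>"

lemma code_funcset: "\<omega> \<in> {1..} \<rightarrow> {1..m}"
  using code by (auto simp: code_space_def PiE_iff)

lemma symbol: "1 \<le> k \<Longrightarrow> \<omega> k \<in> {1..m}"
  using code_funcset by (auto simp: Pi_iff)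

definition X :: "nat \<Rightarrow> real" where
  "X n = coding_map r t (\<lambda>k. \<omega> (n + k))"

lemma X_in_unit: "X n \<in> {0..1}"
  unfolding X_def using code_funcset by (intro word_map_converges(2)) auto

lemma X_step: "X n = S (\<omega> (Suc n)) (X (Suc n))"
  unfolding X_def using coding_map_step[of "\<lambda>k. \<omega> (n + k)"] code_funcset by (simp add: Pi_iff)

lemma word_map_X: "W n (X n) = x"
proof (induction n)
  case 0
  then show ?case
    by (simp add: X_def)
next
  case (Suc n)
  then show ?case
    using X_step[of n] by simp
qed

lemma dist_word_map: "\<bar>W n z - x\<bar> = exp (- B n) * \<bar>z - X n\<bar>"
  using word_map_diff[OF code_funcset, of n z "X n"] by (simp add: word_map_X abs_mult)

lemma dist_fun_word_map: "z \<in> {0..1} \<Longrightarrow> \<bar>F (W n z) - F x\<bar> = exp (- A n) * \<bar>F z - F (X n)\<bar>"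
  using dist_fun_word_map_diff[OF code_funcset _ X_in_unit, of z n n] by (simp add: word_map_X abs_mult)

lemma quot_word_map:
  assumes "z \<in> {0..1}" "z \<noteq> X n" "F z \<noteq> F (X n)"
  shows "quot (W n z) = (A n - ln \<bar>F z - F (X n)\<bar>) / (B n - ln \<bar>z - X n\<bar>)"
proof -
  have "ln \<bar>F (W n z) - F x\<bar> = - (A n - ln \<bar>F z - F (X n)\<bar>)"
    using assms by (simp add: dist_fun_word_map ln_mult)
  moreover have "ln \<bar>W n z - x\<bar> = - (B n - ln \<bar>z - X n\<bar>)"
    using assms by (simp add: dist_word_map ln_mult)
  ultimately show ?thesis
    by (simp only: minus_divide_divide)
qed

lemma B_bounds:
  obtains b b' where "0 < b" "0 < b'" "\<And>n. b * real n \<le> B n" "\<And>n. B n \<le> b' * real n"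
proof -
  define R where "R = (\<lambda>i. - ln (r i)) ` {1..m}"
  have R: "finite R" "R \<noteq> {}"
    using m_ge_2 by (auto simp: R_def)
  have pos: "0 < c" if "c \<in> R" for c
    using that r_pos r_less_1 by (auto simp: R_def)
  have bounds: "Min R \<le> - ln (r (\<omega> k))" "- ln (r (\<omega> k)) \<le> Max R" if "1 \<le> k" for k
    using symbol[OF that] R by (auto simp: R_def)
  show thesis
  proof (rule that[of "Min R" "Max R"])
    show "0 < Min R" "0 < Max R"
      using pos R Min_in Max_in by auto
    show "Min R * real n \<le> B n" for n
      using sum_bounded_below[of "{1..n}" "Min R" "\<lambda>k. - ln (r (\<omega> k))"] bounds(1)
      by (simp add: log_sum_def sum_negf mult.commute)
    show "B n \<le> Max R * real n" for n
      using sum_bounded_above[of "{1..n}" "\<lambda>k. - ln (r (\<omega> k))" "Max R"] bounds(2)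
      by (simp add: log_sum_def sum_negf mult.commute)
  qed
qed

lemma A_nonneg: "0 \<le> A n"
proof -
  have "ln (p (\<omega> k)) \<le> 0" if "k \<in> {1..n}" for k
    using symbol[of k] that p_pos p_less_1 by (simp add: less_imp_le)
  then have "(\<Sum>k=1..n. ln (p (\<omega> k))) \<le> 0"
    by (rule sum_nonpos)
  then show ?thesis
    by (simp add: log_sum_def)
qed

lemma B_pos: "0 < n \<Longrightarrow> 0 < B n"
  by (rule B_bounds) (smt (verit) mult_pos_pos of_nat_0_less_iff)

lemma B_at_top: "filterlim B at_top sequentially"
proof -
  obtain b where b: "0 < b" "\<And>n. b * real n \<le> B n"
    using B_bounds by metis
  have "filterlim (\<lambda>n. b * real n) at_top sequentially"
    using b(1) filterlim_real_sequentially by (intro filterlim_tendsto_pos_mult_at_top[OF tendsto_const])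
  then show ?thesis
    by (rule filterlim_at_top_mono) (use b(2) in auto)
qed

lemma exp_minus_B_tendsto_0: "(\<lambda>n. exp (- B n)) \<longlonglongrightarrow> 0"
  using B_at_top by (intro filterlim_compose[OF exp_at_bot]) (simp add: filterlim_uminus_at_top)

lemma bounded_over_B_tendsto_0:
  assumes "\<And>n. 0 \<le> e n" "\<And>n. e n \<le> c"
  shows "(\<lambda>n. e n / B n) \<longlonglongrightarrow> 0"
proof (rule tendsto_sandwich[of "\<lambda>n. 0" _ _ "\<lambda>n. c / B n"])
  show "\<forall>\<^sub>F n in sequentially. 0 \<le> e n / B n" "\<forall>\<^sub>F n in sequentially. e n / B n \<le> c / B n"
    using eventually_gt_at_top[of 0] by (eventually_elim; use assms B_pos in \<open>simp add: divide_right_mono less_imp_le\<close>)+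
  show "(\<lambda>n. c / B n) \<longlonglongrightarrow> 0"
    by (rule real_tendsto_divide_at_top[OF tendsto_const B_at_top])
qed simp

text \<open>
  The points of \<^term>\<open>K\<close> in first-level pieces other than the piece of \<^term>\<open>X n\<close>. Their images
  under \<^term>\<open>W n\<close> are the points of \<^term>\<open>K\<close> whose longest common cylinder with \<^term>\<open>x\<close> has
  length \<open>n\<close>.
\<close>
definition siblings :: "nat \<Rightarrow> real set" where
  "siblings n = (\<Union>j\<in>{1..m} - {\<omega> (Suc n)}. S j ` K)"

lemma siblings_subset: "siblings n \<subseteq> K"
  using ifs_map_in_attractor by (auto simp: siblings_def)

lemma siblings_gap:
  obtains \<delta> where "0 < \<delta>" "\<delta> \<le> 1" "\<And>n z. z \<in> siblings n \<Longrightarrow> \<delta> \<le> \<bar>z - X n\<bar>"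
proof -
  obtain \<delta> where \<delta>: "0 < \<delta>" "\<delta> \<le> 1"
    "\<And>i j u v. \<lbrakk>i \<in> {1..m}; j \<in> {1..m}; i \<noteq> j; u \<in> {0..1}; v \<in> {0..1}\<rbrakk> \<Longrightarrow> \<delta> \<le> \<bar>S i u - S j v\<bar>"
    by (rule uniform_gap) blast
  have "\<delta> \<le> \<bar>z - X n\<bar>" if "z \<in> siblings n" for n z
  proof -
    obtain j w where "j \<in> {1..m}" "j \<noteq> \<omega> (Suc n)" "w \<in> K" "z = S j w"
      using \<open>z \<in> siblings n\<close> unfolding siblings_def by blast
    then show ?thesis
      using \<delta>(3)[of j "\<omega> (Suc n)" w "X (Suc n)"] symbol[of "Suc n"] X_in_unit attractor_subset_unit
        X_step[of n] by auto
  qed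
  with \<delta>(1,2) that show thesis
    by blast
qed

lemma abs_diff_X_le_1: "z \<in> {0..1} \<Longrightarrow> \<bar>z - X n\<bar> \<le> 1"
  using X_in_unit[of n] by auto

lemma abs_dist_fun_diff_le_1: "\<bar>F u - F v\<bar> \<le> 1"
  using dist_fun_nonneg[of u] dist_fun_le_1[of u] dist_fun_nonneg[of v] dist_fun_le_1[of v] by linarith

text \<open>
  The point \<open>y\<close> cannot share all cylinders with \<^term>\<open>x\<close>, because their diameters tend to \<open>0\<close>;
  take the last cylinder that it shares.
\<close>
lemma split_point:
  assumes "y \<in> K" "y \<noteq> x"
  obtains n z where "z \<in> siblings n" "y = W n z"
proof -
  have "\<exists>n. y \<in> W n ` K \<and> y \<notin> W (Suc n) ` K"
  proof (rule ccontr)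
    assume "\<not> ?thesis"
    then have step: "y \<in> W n ` K \<Longrightarrow> y \<in> W (Suc n) ` K" for n
      by blast
    have all: "y \<in> W n ` K" for n
    proof (induction n)
      case (Suc n)
      then show ?case
        by (rule step)
    qed (use assms in simp)
    have "\<bar>y - x\<bar> \<le> exp (- B n)" for n
    proof -
      obtain z where "z \<in> K" "y = W n z"
        using all[of n] by blast
      then show ?thesis
        using abs_diff_X_le_1[of z n] attractor_subset_unit by (auto simp: dist_word_map mult_left_le)
    qed
    then have "\<bar>y - x\<bar> \<le> 0"
      by (intro LIMSEQ_le_const[OF exp_minus_B_tendsto_0]) simp
    with assms show False
      by simp
  qed
  then obtain n z where n: "y \<notin> W (Suc n) ` K" "z \<in> K" "y = W n z"
    by blast
  obtain j w where jw: "j \<in> {1..m}" "w \<in> K" "z = S j w"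
    using attractor_cases[OF n(2)] .
  have "j \<noteq> \<omega> (Suc n)"
    using n jw by auto
  with jw have "z \<in> siblings n"
    by (auto simp: siblings_def)
  then show thesis
    using n(3) that by blast
qed

lemma B_mono: "n \<le> k \<Longrightarrow> B n \<le> B k"
proof (induction k rule: dec_induct)
  case (step k)
  then show ?case
    using ln_less_zero[OF r_pos r_less_1, OF symbol[of "Suc k"] symbol[of "Suc k"]] by (simp add: log_sum_Suc)
qed simp

text \<open>
  Leaving the cylinder of \<^term>\<open>x\<close> at a level below \<open>N\<close> costs a distance of at least the
  smallest gap, scaled down to the level \<open>N\<close>.
\<close>
lemma eventually_split:
  "\<forall>\<^sub>F y in at x within K. \<exists>n\<ge>N. \<exists>z\<in>siblings n. y = W n z"
proof -
  obtain \<delta> where \<delta>: "0 < \<delta>" "\<And>n z. z \<in> siblings n \<Longrightarrow> \<delta> \<le> \<bar>z - X n\<bar>"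
    by (rule siblings_gap) blast
  define \<eta> where "\<eta> = exp (- B N) * \<delta>"
  have "0 < \<eta>"
    using \<delta>(1) by (simp add: \<eta>_def)
  have "\<exists>n\<ge>N. \<exists>z\<in>siblings n. y = W n z" if y: "y \<in> K" "y \<noteq> x" "dist y x < \<eta>" for y
  proof -
    obtain n z where nz: "z \<in> siblings n" "y = W n z"
      using split_point[OF y(1,2)] .
    have "exp (- B n) * \<delta> \<le> exp (- B n) * \<bar>z - X n\<bar>"
      using \<delta>(2)[OF nz(1)] by simp
    also have "\<dots> < exp (- B N) * \<delta>"
      using y(3) nz(2) by (simp add: dist_real_def dist_word_map \<eta>_def)
    finally have "B N < B n"
      using \<delta>(1) by simp
    then have "N \<le> n"
      using B_mono[of n N] by linarith
    with nz show ?thesis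
      by blast
  qed
  with \<open>0 < \<eta>\<close> show ?thesis
    unfolding eventually_at by blast
qed

text \<open>
  One sibling chosen at each level yields a sequence in \<^term>\<open>K\<close> that converges to \<^term>\<open>x\<close>. The
  correction \<open>- ln \<bar>z n - X n\<bar>\<close> in the denominator of the quotient is bounded and hence disappears
  after division by \<^term>\<open>B n\<close>.
\<close>
lemma ratio_along_siblings:
  assumes lim: "(quot \<longlongrightarrow> \<alpha>) (at x within K)"
    and z: "\<And>n. z n \<in> siblings n" "\<And>n. F (z n) \<noteq> F (X n)"
  shows "(\<lambda>n. (A n - ln \<bar>F (z n) - F (X n)\<bar>) / B n) \<longlonglongrightarrow> \<alpha>"
proof -
  obtain \<delta> where \<delta>: "0 < \<delta>" "\<delta> \<le> 1" "\<And>n z. z \<in> siblings n \<Longrightarrow> \<delta> \<le> \<bar>z - X n\<bar>"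
    by (rule siblings_gap) blast
  define d where "d n = - ln \<bar>z n - X n\<bar>" for n
  have zK: "z n \<in> K" "z n \<in> {0..1}" for n
    using z(1) siblings_subset attractor_subset_unit by blast+
  have gap: "\<delta> \<le> \<bar>z n - X n\<bar>" "\<bar>z n - X n\<bar> \<le> 1" for n
    using \<delta>(3)[OF z(1)] abs_diff_X_le_1[OF zK(2)] by auto
  have ne: "z n \<noteq> X n" for n
    using gap(1)[of n] \<delta>(1) by auto
  have d: "0 \<le> d n" "d n \<le> - ln \<delta>" for n
    using gap[of n] \<delta>(1) ne[of n] by (simp_all add: d_def)
  have Wlim: "filterlim (\<lambda>n. W n (z n)) (at x within K) sequentially"
    unfolding filterlim_at
  proof
    show "\<forall>\<^sub>F n in sequentially. W n (z n) \<in> K \<and> W n (z n) \<noteq> x"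
    proof (rule always_eventually, rule allI, rule conjI)
      fix n
      show "W n (z n) \<in> K"
        using code_funcset zK by (intro word_map_in_attractor) auto
      show "W n (z n) \<noteq> x"
        using dist_word_map[of n "z n"] ne[of n] by auto
    qed
    have "norm (W n (z n) - x) \<le> exp (- B n)" for n
      using gap(2)[of n] by (simp add: dist_word_map mult_left_le)
    then have "\<forall>\<^sub>F n in sequentially. norm (W n (z n) - x) \<le> exp (- B n)"
      by (rule always_eventually[OF allI])
    then have "(\<lambda>n. W n (z n) - x) \<longlonglongrightarrow> 0"
      using exp_minus_B_tendsto_0 by (rule Lim_null_comparison)
    then show "(\<lambda>n. W n (z n)) \<longlonglongrightarrow> x"
      by (rule LIM_zero_cancel)
  qed
  have "(\<lambda>n. quot (W n (z n))) \<longlonglongrightarrow> \<alpha>"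
    using lim Wlim by (rule filterlim_compose)
  moreover have "(\<lambda>n. 1 + d n / B n) \<longlonglongrightarrow> 1 + 0"
    using d by (intro tendsto_intros bounded_over_B_tendsto_0) auto
  ultimately have "(\<lambda>n. quot (W n (z n)) * (1 + d n / B n)) \<longlonglongrightarrow> \<alpha> * (1 + 0)"
    by (rule tendsto_mult)
  moreover have "\<forall>\<^sub>F n in sequentially. quot (W n (z n)) * (1 + d n / B n) = (A n - ln \<bar>F (z n) - F (X n)\<bar>) / B n"
    using eventually_gt_at_top[of 0]
  proof eventually_elim
    case (elim n)
    have "0 < B n" "0 < B n + d n"
      using B_pos[OF elim] d(1)[of n] by auto
    then show ?case
      using quot_word_map[OF zK(2) ne z(2)] by (simp add: d_def field_simps)
  qed
  ultimately show ?thesis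
    by (simp add: filterlim_cong)
qed

text \<open>
  If \<^term>\<open>X n\<close> is in the first piece, the whole mass of the last piece separates it from \<open>1\<close>;
  otherwise the mass of the first piece separates it from \<open>0\<close>.
\<close>
lemma far_sibling:
  obtains q where "0 < q" "\<And>n. \<exists>z\<in>siblings n. q \<le> \<bar>F z - F (X n)\<bar>"
proof -
  obtain q where q: "0 < q" "\<And>i. i \<in> {1..m} \<Longrightarrow> q \<le> p i"
    using uniform_weight by metis
  have "\<exists>z\<in>siblings n. q \<le> \<bar>F z - F (X n)\<bar>" for n
  proof (cases "\<omega> (Suc n) = 1")
    case True
    have "S m 1 \<in> siblings n"
      unfolding siblings_def using True m_ge_2 one_in_attractor by (intro UN_I[of m] imageI) auto
    moreover have "S m 1 = 1"
      using t_last by (simp add: ifs_map_def)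
    moreover have "F (X n) = p 1 * F (X (Suc n))"
      using dist_fun_ifs_map[of 1 "X (Suc n)"] X_step[of n] X_in_unit m_ge_2 True by simp
    then have "F (X n) \<le> p 1"
      using p_pos[of 1] m_ge_2 dist_fun_le_1 by (simp add: mult_left_le)
    moreover have "p 1 + q \<le> 1"
      using weight_split[of 1 m] weight_total q(2)[of m] m_ge_2 by simp
    ultimately show ?thesis
      using dist_fun_1 by (intro bexI[of _ "S m 1"]) auto
  next
    case False
    have "S 1 0 \<in> siblings n"
      unfolding siblings_def using False m_ge_2 zero_in_attractor by (intro UN_I[of 1] imageI) auto
    moreover have "S 1 0 = 0"
      using t_first by (simp add: ifs_map_def)
    moreover have "q \<le> F (X n)"
    proof -
      have i: "\<omega> (Suc n) \<in> {1..m}"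
        using symbol by simp
      have "p 1 \<le> sum p {1..<\<omega> (Suc n)}"
        using weight_split[OF _ i, of 1] False i m_ge_2 by simp
      moreover have "0 \<le> p (\<omega> (Suc n)) * F (X (Suc n))"
        using p_pos[OF i] dist_fun_nonneg by simp
      ultimately show ?thesis
        using dist_fun_ifs_map[OF i X_in_unit] X_step[of n] q(2)[of 1] m_ge_2 by simp
    qed
    ultimately show ?thesis
      using dist_fun_0 by (intro bexI[of _ "S 1 0"]) auto
  qed
  with q(1) that show thesis
    by blast
qed

text \<open>
  Along far siblings the correction in the numerator is bounded too.
\<close>
lemma log_ratio_of_quot:
  assumes lim: "(quot \<longlongrightarrow> \<alpha>) (at x within K)"
  shows "(\<lambda>n. A n / B n) \<longlonglongrightarrow> \<alpha>"
proof -
  obtain q where q: "0 < q" "\<And>n. \<exists>z\<in>siblings n. q \<le> \<bar>F z - F (X n)\<bar>"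
    by (rule far_sibling) blast
  then obtain z where z: "\<And>n. z n \<in> siblings n" "\<And>n. q \<le> \<bar>F (z n) - F (X n)\<bar>"
    by metis
  define e where "e n = - ln \<bar>F (z n) - F (X n)\<bar>" for n
  have ne: "F (z n) \<noteq> F (X n)" for n
    using z(2)[of n] q(1) by auto
  have "0 \<le> e n" "e n \<le> - ln q" for n
    using z(2)[of n] ne[of n] q(1) abs_dist_fun_diff_le_1 by (simp_all add: e_def)
  then have "(\<lambda>n. e n / B n) \<longlonglongrightarrow> 0"
    by (rule bounded_over_B_tendsto_0)
  with ratio_along_siblings[OF lim z(1) ne]
  have "(\<lambda>n. (A n - ln \<bar>F (z n) - F (X n)\<bar>) / B n - e n / B n) \<longlonglongrightarrow> \<alpha> - 0"
    by (rule tendsto_diff)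
  moreover have "(A n - ln \<bar>F (z n) - F (X n)\<bar>) / B n - e n / B n = A n / B n" for n
    by (simp add: e_def diff_divide_distrib)
  ultimately show ?thesis
    by simp
qed

end

section \<open>The two ends of the unit interval\<close>

text \<open>
  One end of the unit interval, with \<open>s\<close> the symbol of the piece containing it and \<open>G z\<close> the mass
  between \<open>z\<close> and that end. The last assumption provides, for every piece not containing the end,
  the point across the gap on the side of that end: the increment of \<^term>\<open>F\<close> up to that point is
  exactly the mass remaining inside the piece. The locale is used for the left end
  (\<open>s = 1\<close>, \<open>G = F\<close>) and the right end (\<open>s = m\<close>, \<open>G = 1 - F\<close>), which saves a reflection argument.
\<close>
locale cantor_end = coded_point +
  fixes s :: nat and G :: "real \<Rightarrow> real"
  assumes s: "s \<in> {1..m}"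
    and G_le_1: "z \<in> {0..1} \<Longrightarrow> G z \<le> 1"
    and G_end: "z \<in> {0..1} \<Longrightarrow> G (S s z) = p s * G z"
    and G_inner: "\<lbrakk>i \<in> {1..m}; i \<noteq> s; z \<in> {0..1}\<rbrakk> \<Longrightarrow> p s \<le> G (S i z)"
    and neighbour: "\<lbrakk>i \<in> {1..m}; i \<noteq> s\<rbrakk> \<Longrightarrow>
      \<exists>j\<in>{1..m} - {i}. \<exists>w\<in>K. \<forall>u\<in>{0..1}. \<bar>F (S j w) - F (S i u)\<bar> = p i * G u"
begin

lemma G_run:
  assumes "\<And>j. j \<in> {1..l} \<Longrightarrow> \<omega> (n + j) = s"
  shows "G (X n) = p s ^ l * G (X (n + l))"
  using assms
proof (induction l)
  case (Suc l)
  have "\<omega> (Suc (n + l)) = s"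
    using Suc.prems[of "Suc l"] by simp
  then have "G (X (n + l)) = p s * G (X (Suc (n + l)))"
    using G_end X_in_unit X_step by metis
  then show ?case
    using Suc by simp
qed simp

text \<open>
  Each symbol \<open>s\<close> multiplies the mass remaining towards the end by \<open>p s\<close>. After the run, the
  point lies in another piece, and the whole piece of the end is still ahead.
\<close>
lemma G_bounds:
  assumes "\<exists>j>n. \<omega> j \<noteq> s"
  shows "p s ^ Suc (run_length s \<omega> n) \<le> G (X n)" "G (X n) \<le> p s ^ run_length s \<omega> n"
proof -
  let ?l = "run_length s \<omega> n"
  have eq: "G (X n) = p s ^ ?l * G (X (n + ?l))"
    by (rule G_run[OF run_lengthD(1)[OF assms]])
  have "p s \<le> G (X (n + ?l))"
    unfolding X_step[of "n + ?l"] using run_lengthD(2)[OF assms] X_in_unit symbol by (intro G_inner) auto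
  then show "p s ^ Suc ?l \<le> G (X n)"
    using p_pos[OF s] by (simp add: eq mult.commute)
  show "G (X n) \<le> p s ^ ?l"
    using p_pos[OF s] G_le_1[OF X_in_unit] by (simp add: eq mult_left_le)
qed

text \<open>
  The estimate fails only for a constant tail \<open>s\<close>, where \<^term>\<open>G\<close> vanishes; but then the symbol
  before the tail is eventually \<open>s\<close> as well, and no sibling lies on the side of the end.
\<close>
lemma eventually_G_lower:
  "\<exists>N. \<forall>n\<ge>N. \<omega> (Suc n) \<noteq> s \<longrightarrow> p s ^ Suc (run_length s \<omega> (Suc n)) \<le> G (X (Suc n))"
proof (cases "\<exists>k. \<forall>j>k. \<omega> j = s")
  case True
  then show ?thesis
    by (metis less_Suc_eq_le)
next
  case False
  then show ?thesis
    using G_bounds(1) by blast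
qed

text \<open>
  A run of \<open>s\<close> that begins after another symbol at position \<open>n + 1\<close> is tested with the neighbour
  across the gap, where the increment is at most \<open>p s\<close> to the power of the run length. The
  logarithm of the increment is \<open>o(B n)\<close> by comparison with \<open>A n / B n\<close>, hence so is the run
  length.
\<close>
lemma run_length_of_quot:
  assumes lim: "(quot \<longlongrightarrow> \<alpha>) (at x within K)"
  shows "(\<lambda>n. real (run_length s \<omega> n) / real n) \<longlonglongrightarrow> 0"
proof (rule run_length_negligible)
  fix \<epsilon> :: real assume "0 < \<epsilon>"
  let ?L = "\<lambda>n. run_length s \<omega> (Suc n)"
  \<comment> \<open>At levels where no finite run begins, any point with a nonzero increment completes the
    sequence.\<close>
  have "\<exists>z\<in>siblings n. F z \<noteq> F (X n) \<and> (\<omega> (Suc n) \<noteq> s \<and> 0 < ?L n \<longrightarrow> \<bar>F z - F (X n)\<bar> \<le> p s ^ ?L n)" for n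
  proof (cases "\<omega> (Suc n) \<noteq> s \<and> 0 < ?L n")
    case True
    define i where "i = \<omega> (Suc n)"
    have i: "i \<in> {1..m}" "i \<noteq> s"
      using True symbol by (auto simp: i_def)
    then obtain j w where jw: "j \<in> {1..m} - {i}" "w \<in> K"
      "\<And>u. u \<in> {0..1} \<Longrightarrow> \<bar>F (S j w) - F (S i u)\<bar> = p i * G u"
      using neighbour by metis
    have eq: "\<bar>F (S j w) - F (X n)\<bar> = p i * G (X (Suc n))"
      using jw(3)[OF X_in_unit] X_step[of n] by (simp add: i_def)
    have tail: "\<exists>j>Suc n. \<omega> j \<noteq> s"
      using True run_length_pos_imp_tail by blast
    have G: "0 < G (X (Suc n))"
      using G_bounds(1)[OF tail] p_pos[OF s] by (meson less_le_trans zero_less_power)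
    have "p i * G (X (Suc n)) \<le> G (X (Suc n))"
      using G p_less_1[OF i(1)] by simp
    then have "\<bar>F (S j w) - F (X n)\<bar> \<le> p s ^ ?L n"
      using eq G_bounds(2)[OF tail] by linarith
    moreover have "F (S j w) \<noteq> F (X n)"
      using eq G p_pos[OF i(1)] by auto
    moreover have "S j w \<in> siblings n"
      using jw by (auto simp: siblings_def i_def)
    ultimately show ?thesis
      by blast
  next
    case False
    obtain q where "0 < q" "\<exists>z\<in>siblings n. q \<le> \<bar>F z - F (X n)\<bar>"
      using far_sibling by metis
    with False show ?thesis
      by force
  qed
  then obtain z where z: "\<And>n. z n \<in> siblings n" "\<And>n. F (z n) \<noteq> F (X n)"
    "\<And>n. \<lbrakk>\<omega> (Suc n) \<noteq> s; 0 < ?L n\<rbrakk> \<Longrightarrow> \<bar>F (z n) - F (X n)\<bar> \<le> p s ^ ?L n"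
    by metis
  define e where "e n = - ln \<bar>F (z n) - F (X n)\<bar>" for n
  define c where "c = - ln (p s)"
  have c: "0 < c"
    using p_pos[OF s] p_less_1[OF s] by (simp add: c_def)
  obtain b where b: "0 < b" "\<And>n. B n \<le> b * real n"
    using B_bounds by metis
  have "(\<lambda>n. (A n - ln \<bar>F (z n) - F (X n)\<bar>) / B n - A n / B n) \<longlonglongrightarrow> \<alpha> - \<alpha>"
    by (intro tendsto_diff ratio_along_siblings log_ratio_of_quot lim z)
  moreover have "(A n - ln \<bar>F (z n) - F (X n)\<bar>) / B n - A n / B n = e n / B n" for n
    by (simp add: e_def diff_divide_distrib)
  ultimately have "(\<lambda>n. e n / B n) \<longlonglongrightarrow> 0"
    by simp
  moreover have "0 < \<epsilon> * c / b"
    using \<open>0 < \<epsilon>\<close> b c by simp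
  ultimately have "\<forall>\<^sub>F n in sequentially. e n / B n < \<epsilon> * c / b"
    by (rule order_tendstoD(2))
  then have "\<forall>\<^sub>F n in sequentially. \<omega> (Suc n) \<noteq> s \<longrightarrow> real (?L n) \<le> \<epsilon> * real n"
    using eventually_gt_at_top[of 0]
  proof eventually_elim
    case (elim n)
    show ?case
    proof (intro impI, cases "?L n = 0")
      case False
      assume "\<omega> (Suc n) \<noteq> s"
      then have "ln \<bar>F (z n) - F (X n)\<bar> \<le> ln (p s ^ ?L n)"
        using False z(2,3)[of n] p_pos[OF s] by (subst ln_le_cancel_iff) auto
      then have "real (?L n) * c \<le> e n"
        using p_pos[OF s] by (simp add: e_def c_def ln_realpow)
      also have "\<dots> \<le> \<epsilon> * c / b * B n"
        using elim B_pos[of n] by (simp add: pos_divide_less_eq)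
      also have "\<dots> \<le> \<epsilon> * c / b * (b * real n)"
        using b(2)[of n] \<open>0 < \<epsilon> * c / b\<close> by (intro mult_left_mono) auto
      also have "\<dots> = \<epsilon> * real n * c"
        using b(1) by simp
      finally show "real (?L n) \<le> \<epsilon> * real n"
        using c by simp
    qed (use \<open>0 < \<epsilon>\<close> in simp)
  qed
  then show "\<exists>N. \<forall>n\<ge>N. \<omega> (Suc n) \<noteq> s \<longrightarrow> real (?L n) \<le> \<epsilon> * real n"
    by (simp add: eventually_sequentially)
qed

end

context coded_point
begin

sublocale left: cantor_end m r t p K \<mu> \<omega> 1 F
proof
  show "1 \<in> {1..m}"
    using m_ge_2 by simp
  show "F z \<le> 1" for z
    by (rule dist_fun_le_1)
  show "F (S 1 z) = p 1 * F z" if "z \<in> {0..1}" for z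
    using dist_fun_ifs_map[of 1 z] that m_ge_2 by simp
  show "p 1 \<le> F (S i z)" if "i \<in> {1..m}" "i \<noteq> 1" "z \<in> {0..1}" for i z
  proof -
    have "p 1 \<le> sum p {1..<i}"
      using weight_split[of 1 i] that by simp
    moreover have "0 \<le> p i * F z"
      using p_pos[OF that(1)] dist_fun_nonneg by simp
    ultimately show ?thesis
      using dist_fun_ifs_map[OF that(1,3)] by simp
  qed
  show "\<exists>j\<in>{1..m} - {i}. \<exists>w\<in>K. \<forall>u\<in>{0..1}. \<bar>F (S j w) - F (S i u)\<bar> = p i * F u"
    if i: "i \<in> {1..m}" "i \<noteq> 1" for i
  proof (intro bexI ballI)
    show j: "i - 1 \<in> {1..m} - {i}" and "1 \<in> K"
      using i one_in_attractor by auto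
    fix u :: real assume u: "u \<in> {0..1}"
    have "{1..<i} = insert (i - 1) {1..<i - 1}"
      using i by auto
    then have "F (S (i - 1) 1) = sum p {1..<i}"
      using dist_fun_ifs_map[of "i - 1" 1] j by (simp add: dist_fun_1)
    then show "\<bar>F (S (i - 1) 1) - F (S i u)\<bar> = p i * F u"
      using dist_fun_ifs_map[OF i(1) u] p_pos[OF i(1)] dist_fun_nonneg[of u] by (simp add: abs_mult)
  qed
qed

sublocale right: cantor_end m r t p K \<mu> \<omega> m "\<lambda>z. 1 - F z"
proof
  show m: "m \<in> {1..m}"
    using m_ge_2 by simp
  show "1 - F z \<le> 1" for z
    using dist_fun_nonneg[of z] by simp
  show "1 - F (S m z) = p m * (1 - F z)" if "z \<in> {0..1}" for z
    using dist_fun_ifs_map[OF m that] weight_total by (simp add: algebra_simps)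
  show "p m \<le> 1 - F (S i z)" if "i \<in> {1..m}" "i \<noteq> m" "z \<in> {0..1}" for i z
  proof -
    have "sum p {1..<i} + p i \<le> 1 - p m"
      using weight_split[of i m] weight_total that by simp
    moreover have "p i * F z \<le> p i"
      using p_pos[OF that(1)] dist_fun_le_1 by (simp add: mult_left_le)
    ultimately show ?thesis
      using dist_fun_ifs_map[OF that(1,3)] by simp
  qed
  show "\<exists>j\<in>{1..m} - {i}. \<exists>w\<in>K. \<forall>u\<in>{0..1}. \<bar>F (S j w) - F (S i u)\<bar> = p i * (1 - F u)"
    if i: "i \<in> {1..m}" "i \<noteq> m" for i
  proof (intro bexI ballI)
    show j: "Suc i \<in> {1..m} - {i}" and "0 \<in> K"
      using i zero_in_attractor by auto
    fix u :: real assume u: "u \<in> {0..1}"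
    have "{1..<Suc i} = insert i {1..<i}"
      using i by auto
    then have "F (S (Suc i) 0) = sum p {1..<i} + p i"
      using dist_fun_ifs_map[of "Suc i" 0] j by (simp add: dist_fun_0)
    then have "F (S (Suc i) 0) - F (S i u) = p i * (1 - F u)"
      using dist_fun_ifs_map[OF i(1) u] by (simp add: algebra_simps)
    then show "\<bar>F (S (Suc i) 0) - F (S i u)\<bar> = p i * (1 - F u)"
      using p_pos[OF i(1)] dist_fun_le_1[of u] by (simp add: abs_mult)
  qed
qed

section \<open>Endpoint runs and the quotient\<close>

lemma endpoint_run_of_quot:
  assumes lim: "(quot \<longlongrightarrow> \<alpha>) (at x within K)"
  shows "(\<lambda>n. real (endpoint_run m \<omega> n) / real n) \<longlonglongrightarrow> 0"
proof -
  have "(\<lambda>n. max (real (run_length 1 \<omega> n) / real n) (real (run_length m \<omega> n) / real n)) \<longlonglongrightarrow> max 0 0"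
    by (intro tendsto_max left.run_length_of_quot[OF lim] right.run_length_of_quot[OF lim])
  then show ?thesis
    by (simp add: endpoint_run_def of_nat_max max_divide_distrib_right)
qed

text \<open>
  The increment from \<^term>\<open>X n\<close> to a sibling contains the mass remaining in the piece of
  \<^term>\<open>X n\<close> towards the sibling. One factor \<open>q\<close> accounts for the weight of that piece, the
  other factors for the run that follows and the symbol that ends it.
\<close>
lemma eventually_sibling_increment:
  obtains q N where "0 < q" "q < 1"
    "\<And>n z. \<lbrakk>N \<le> n; z \<in> siblings n\<rbrakk> \<Longrightarrow> q ^ (endpoint_run m \<omega> (Suc n) + 2) \<le> \<bar>F z - F (X n)\<bar>"
proof -
  obtain q where q: "0 < q" "q < 1" "\<And>i. i \<in> {1..m} \<Longrightarrow> q \<le> p i"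
    by (rule uniform_weight) blast
  obtain N1 where N1: "\<And>n. \<lbrakk>N1 \<le> n; \<omega> (Suc n) \<noteq> 1\<rbrakk> \<Longrightarrow> p 1 ^ Suc (run_length 1 \<omega> (Suc n)) \<le> F (X (Suc n))"
    using left.eventually_G_lower by blast
  obtain N2 where N2: "\<And>n. \<lbrakk>N2 \<le> n; \<omega> (Suc n) \<noteq> m\<rbrakk> \<Longrightarrow> p m ^ Suc (run_length m \<omega> (Suc n)) \<le> 1 - F (X (Suc n))"
    using right.eventually_G_lower by blast
  have "q ^ (endpoint_run m \<omega> (Suc n) + 2) \<le> \<bar>F z - F (X n)\<bar>"
    if n: "max N1 N2 \<le> n" and z: "z \<in> siblings n" for n z
  proof -
    define i where "i = \<omega> (Suc n)"
    let ?R = "endpoint_run m \<omega> (Suc n)"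
    obtain j w where jw: "j \<in> {1..m}" "j \<noteq> i" "w \<in> K" "z = S j w"
      using z unfolding siblings_def i_def by blast
    have i: "i \<in> {1..m}"
      using symbol by (simp add: i_def)
    have w: "w \<in> {0..1}"
      using jw(3) attractor_subset_unit by blast
    have FX: "F (X n) = sum p {1..<i} + p i * F (X (Suc n))"
      using dist_fun_ifs_map[OF i X_in_unit] X_step[of n] by (simp add: i_def)
    have Fz: "F z = sum p {1..<j} + p j * F w"
      using dist_fun_ifs_map[OF jw(1) w] jw(4) by simp
    have pFw: "0 \<le> p j * F w" "p j * F w \<le> p j"
      using p_pos[OF jw(1)] dist_fun_nonneg[of w] dist_fun_le_1[of w] by (simp_all add: mult_left_le)
    have bound: "q ^ (?R + 2) \<le> p i * g"
      if "l \<le> ?R" "k \<in> {1..m}" "p k ^ Suc l \<le> g" for l k g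
    proof -
      have "q ^ Suc ?R \<le> q ^ Suc l"
        using q that(1) by (intro power_decreasing) auto
      also have "\<dots> \<le> p k ^ Suc l"
        using q(1) q(3)[OF that(2)] by (intro power_mono) auto
      finally have "q ^ Suc ?R \<le> g"
        using that(3) by linarith
      then have "q * q ^ Suc ?R \<le> p i * g"
        using q(1) q(3)[OF i] by (intro mult_mono) auto
      then show ?thesis
        by simp
    qed
    show ?thesis
    proof (cases "i < j")
      case True
      have "q ^ (?R + 2) \<le> p i * (1 - F (X (Suc n)))"
        using n True jw(1) m_ge_2 N2[of n]
        by (intro bound[of "run_length m \<omega> (Suc n)" m]) (auto simp: endpoint_run_def i_def)
      also have "\<dots> \<le> F z - F (X n)"
        using weight_split[OF i jw(1) True] FX Fz pFw by (simp add: algebra_simps)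
      finally show ?thesis
        by simp
    next
      case False
      then have "j < i"
        using jw(2) by simp
      have "q ^ (?R + 2) \<le> p i * F (X (Suc n))"
        using n \<open>j < i\<close> jw(1) m_ge_2 N1[of n]
        by (intro bound[of "run_length 1 \<omega> (Suc n)" 1]) (auto simp: endpoint_run_def i_def)
      also have "\<dots> \<le> F (X n) - F z"
        using weight_split[OF jw(1) i \<open>j < i\<close>] FX Fz pFw by simp
      finally show ?thesis
        by simp
    qed
  qed
  with q(1,2) that show thesis
    by blast
qed

text \<open>
  Bounding the corrections in numerator and denominator by their extreme values gives two
  sequences that depend on the level only and both tend to \<open>\<alpha>\<close>.
\<close>
lemma quot_of_log_ratio:
  assumes ratio: "(\<lambda>n. A n / B n) \<longlonglongrightarrow> \<alpha>"
    and runs: "(\<lambda>n. real (endpoint_run m \<omega> n) / real n) \<longlonglongrightarrow> 0"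
  shows "(quot \<longlongrightarrow> \<alpha>) (at x within K)"
proof -
  let ?R = "\<lambda>n. real (endpoint_run m \<omega> (Suc n))"
  obtain q N where q: "0 < q" "q < 1" and
    incr: "\<And>n z. \<lbrakk>N \<le> n; z \<in> siblings n\<rbrakk> \<Longrightarrow> q ^ (endpoint_run m \<omega> (Suc n) + 2) \<le> \<bar>F z - F (X n)\<bar>"
    by (rule eventually_sibling_increment) blast
  obtain \<delta> where \<delta>: "0 < \<delta>" "\<delta> \<le> 1" "\<And>n z. z \<in> siblings n \<Longrightarrow> \<delta> \<le> \<bar>z - X n\<bar>"
    by (rule siblings_gap) blast
  obtain b where b: "0 < b" "\<And>n. b * real n \<le> B n"
    using B_bounds by metis
  define C where "C = - ln q"
  define D where "D = - ln \<delta>"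
  have C: "0 < C" and D: "0 \<le> D"
    using q \<delta> by (simp_all add: C_def D_def)
  define lo where "lo n = A n / (B n + D)" for n
  define up where "up n = (A n + C * (?R n + 2)) / B n" for n
  have sandwich: "lo n \<le> quot (W n z)" "quot (W n z) \<le> up n"
    if n: "N \<le> n" "0 < n" and z: "z \<in> siblings n" for n z
  proof -
    define d where "d = - ln \<bar>z - X n\<bar>"
    define e where "e = - ln \<bar>F z - F (X n)\<bar>"
    have zu: "z \<in> {0..1}"
      using z siblings_subset attractor_subset_unit by blast
    have gap: "\<delta> \<le> \<bar>z - X n\<bar>"
      by (rule \<delta>(3)[OF z])
    have ne: "z \<noteq> X n"
      using gap \<delta>(1) by auto
    have d: "0 \<le> d" "d \<le> D"
      using gap \<delta>(1) ne abs_diff_X_le_1[OF zu, of n] by (simp_all add: d_def D_def)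
    have "0 < q ^ (endpoint_run m \<omega> (Suc n) + 2)"
      using q by simp
    then have neF: "F z \<noteq> F (X n)"
      using incr[OF n(1) z] by auto
    have "ln (q ^ (endpoint_run m \<omega> (Suc n) + 2)) \<le> ln \<bar>F z - F (X n)\<bar>"
      using incr[OF n(1) z] q neF by (subst ln_le_cancel_iff) auto
    then have e: "0 \<le> e" "e \<le> C * (?R n + 2)"
      using q neF abs_dist_fun_diff_le_1[of z "X n"]
      by (simp_all add: e_def C_def ln_realpow ln_mult algebra_simps)
    have eq: "quot (W n z) = (A n + e) / (B n + d)"
      using quot_word_map[OF zu ne neF] by (simp add: d_def e_def)
    have "0 < B n"
      by (rule B_pos[OF n(2)])
    then show "lo n \<le> quot (W n z)" "quot (W n z) \<le> up n"
      unfolding eq lo_def up_def using d e A_nonneg[of n] by (intro frac_le; simp)+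
  qed
  have "(\<lambda>n. A n / B n / (1 + D / B n)) \<longlonglongrightarrow> \<alpha> / (1 + 0)"
    using D by (intro tendsto_intros ratio bounded_over_B_tendsto_0) auto
  moreover have "\<forall>\<^sub>F n in sequentially. A n / B n / (1 + D / B n) = lo n"
    using eventually_gt_at_top[of 0]
  proof eventually_elim
    case (elim n)
    have "0 < B n" "0 < B n + D"
      using B_pos[OF elim] D by auto
    then show ?case
      by (simp add: lo_def field_simps)
  qed
  ultimately have lo: "lo \<longlonglongrightarrow> \<alpha>"
    by (simp add: filterlim_cong)
  have "(\<lambda>n. ?R n / B n) \<longlonglongrightarrow> 0"
  proof (rule tendsto_sandwich[of "\<lambda>n. 0" _ _ "\<lambda>n. ?R n / real (Suc n) * (2 / b)"])
    show "\<forall>\<^sub>F n in sequentially. 0 \<le> ?R n / B n"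
      using eventually_gt_at_top[of 0] by eventually_elim (use B_pos in \<open>simp add: less_imp_le\<close>)
    show "\<forall>\<^sub>F n in sequentially. ?R n / B n \<le> ?R n / real (Suc n) * (2 / b)"
      using eventually_gt_at_top[of 0]
    proof eventually_elim
      case (elim n)
      \<comment> \<open>The factor \<open>2\<close> absorbs the shift from \<open>n + 1\<close> to \<open>n\<close>.\<close>
      have "b * real (Suc n) \<le> 2 * (b * real n)"
        using elim b(1) by simp
      also have "\<dots> \<le> 2 * B n"
        using b(2)[of n] by simp
      finally have "?R n / B n \<le> ?R n / (b * real (Suc n) / 2)"
        using b(1) by (intro divide_left_mono mult_pos_pos B_pos elim) auto
      then show ?case
        by (simp add: mult.commute)
    qed
    have "(\<lambda>n. ?R n / real (Suc n) * (2 / b)) \<longlonglongrightarrow> 0 * (2 / b)"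
      by (intro tendsto_intros LIMSEQ_Suc[OF runs])
    then show "(\<lambda>n. ?R n / real (Suc n) * (2 / b)) \<longlonglongrightarrow> 0"
      by simp
  qed simp
  moreover have "(\<lambda>n. 2 / B n) \<longlonglongrightarrow> 0"
    by (rule bounded_over_B_tendsto_0) auto
  ultimately have "(\<lambda>n. A n / B n + C * (?R n / B n + 2 / B n)) \<longlonglongrightarrow> \<alpha> + C * (0 + 0)"
    by (intro tendsto_add tendsto_mult tendsto_const ratio)
  then have up: "up \<longlonglongrightarrow> \<alpha>"
    by (simp add: up_def[abs_def] add_divide_distrib distrib_left)
  show ?thesis
  proof (rule order_tendstoI)
    fix a assume "a < \<alpha>"
    then obtain M where M: "\<And>n. M \<le> n \<Longrightarrow> a < lo n"
      using order_tendstoD(1)[OF lo] by (auto simp: eventually_sequentially)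
    show "\<forall>\<^sub>F y in at x within K. a < quot y"
      using eventually_split[of "max M (Suc N)"]
    proof eventually_elim
      case (elim y)
      then obtain n z where "max M (Suc N) \<le> n" "z \<in> siblings n" "y = W n z"
        by blast
      then show ?case
        using M[of n] sandwich(1)[of n z] by simp
    qed
  next
    fix a assume "\<alpha> < a"
    then obtain M where M: "\<And>n. M \<le> n \<Longrightarrow> up n < a"
      using order_tendstoD(2)[OF up] by (auto simp: eventually_sequentially)
    show "\<forall>\<^sub>F y in at x within K. quot y < a"
      using eventually_split[of "max M (Suc N)"]
    proof eventually_elim
      case (elim y)
      then obtain n z where "max M (Suc N) \<le> n" "z \<in> siblings n" "y = W n z"
        by blast
      then show ?case
        using M[of n] sandwich(2)[of n z] by simp
    qed
  qed
qed

end

section \<open>The characterisation\<close>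

theorem theorem2p1:
  fixes m :: nat and r t p :: "nat \<Rightarrow> real" and K :: "real set" and \<mu> :: "real measure"
    and \<omega> :: "nat \<Rightarrow> nat" and x \<alpha> :: real
  assumes "ifs_condition m r t"
    and "is_attractor m r t K"
    and "positive_prob_vector m p"
    and "is_self_similar_measure m r t p \<mu>"
    and "\<omega> \<in> code_space m"
    and "x = coding_map r t \<omega>"
    and "0 < \<alpha>"
  shows "((\<lambda>y. ln \<bar>dist_fun \<mu> y - dist_fun \<mu> x\<bar> / ln \<bar>y - x\<bar>) \<longlongrightarrow> \<alpha>) (at x within K)
    \<longleftrightarrow> ((\<lambda>n. log_sum p \<omega> n / log_sum r \<omega> n) \<longlonglongrightarrow> \<alpha>) \<and>
        ((\<lambda>n. real (endpoint_run m \<omega> n) / real n) \<longlonglongrightarrow> 0)"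
proof -
  interpret coded_point m r t p K \<mu> \<omega>
    using assms by unfold_locales
  show ?thesis
    unfolding assms(6) using log_ratio_of_quot endpoint_run_of_quot quot_of_log_ratio by blast
qed

end
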